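(* Let $A_1,\dots,A_m\in\mathbb{S}^n$ be such that $I_n,A_1,\dots,A_m$ are linearly independent, and let $\mathbf{b}\in\operatorname{int}\mathscr{M}$. Consider the convex unconstrained minimization problem $$d^\star:=\min_{\mathbf{y}\in\mathbb{R}^m} f(\mathbf{y}),\qquad f(\mathbf{y})=\log\operatorname{tr}\exp A(\mathbf{y})-\mathbf{b}^T\mathbf{y},$$ and the concave maximum entropy problem $$p^\star:=\max_{X\in\mathbb{S}^n_1} S(X)\quad\text{s.t.}\quad \mathcal{A}(X)=\mathbf{b},\qquad S(X):=-\operatorname{tr}(X\log X).$$ Then strong duality holds, i.e. $p^\star=d^\star$, and both extrema are attained. The dual minimizer $\mathbf{y}^\star$ is unique, and the unique primal maximizer is $X^\star=\exp_1 A(\mathbf{y}^\star)\succ 0$; in particular $\mathcal{A}(X^\star)=\mathbf{b}$.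
   Context: $\mathbb{S}^n$ is the space of real symmetric $n\times n$ matrices, and $\mathbb{S}^n_1=\{X\in\mathbb{S}^n: X\succeq 0,\ \operatorname{tr}X=1\}$ is the spectraplex. For given $A_1,\dots,A_m\in\mathbb{S}^n$, define $\mathcal{A}:\mathbb{S}^n\to\mathbb{R}^m$, $\mathcal{A}(X)=(\operatorname{tr}(A_iX))_{i=1,\dots,m}$, and $A(\mathbf{y})=\sum_{i=1}^m y_iA_i$ for $\mathbf{y}\in\mathbb{R}^m$. The moment body is $\mathscr{M}=\mathcal{A}(\mathbb{S}^n_1)\subset\mathbb{R}^m$, and $\operatorname{int}\mathscr{M}$ is its interior in $\mathbb{R}^m$. For symmetric $Z$, $\exp_1 Z:=\exp Z/\operatorname{tr}\exp Z$. In $S(X)$, for singular $X$, the convention $0\log 0=0$ is used on eigenvalues. *)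

theory Defs
  imports "HOL-Analysis.Analysis"
begin

definition sym_mats :: "(real^'n^'n) set" where
  "sym_mats = {X. transpose X = X}"

definition pos_semidef :: "real^'n^'n \<Rightarrow> bool" where
  "pos_semidef X \<longleftrightarrow> X \<in> sym_mats \<and> (\<forall>v. 0 \<le> v \<bullet> (X *v v))"

definition pos_def :: "real^'n^'n \<Rightarrow> bool" where
  "pos_def X \<longleftrightarrow> X \<in> sym_mats \<and> (\<forall>v. v \<noteq> 0 \<longrightarrow> 0 < v \<bullet> (X *v v))"

definition spectraplex :: "(real^'n^'n) set" where
  "spectraplex = {X. pos_semidef X \<and> trace X = 1}"


text \<open>On \<open>real^'n^'n\<close> the library's \<open>*\<close> and \<open>^\<close> are componentwise, so the matrix
  exponential is defined here by its power series with respect to \<open>**\<close>.\<close>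

definition mat_exp :: "real^'n^'n \<Rightarrow> real^'n^'n" where
  "mat_exp Z = (\<Sum>k. (1 / fact k) *\<^sub>R ((((**) Z) ^^ k) (mat 1)))"

definition mat_exp1 :: "real^'n^'n \<Rightarrow> real^'n^'n" where
  "mat_exp1 Z = (1 / trace (mat_exp Z)) *\<^sub>R mat_exp Z"


definition diag_mat :: "real^'n \<Rightarrow> real^'n^'n" where
  "diag_mat d = (\<chi> i j. if i = j then d $ i else 0)"

text \<open>Functional calculus on symmetric matrices: the scalar function is applied to the
  eigenvalues. The value does not depend on the spectral decomposition, see
  \<open>spectral_fun_eq\<close> below.\<close>

definition spectral_fun :: "(real \<Rightarrow> real) \<Rightarrow> real^'n^'n \<Rightarrow> real^'n^'n" where
  "spectral_fun h X =
     (THE Y. \<exists>P d. orthogonal_matrix P \<and> X = P ** diag_mat d ** transpose P \<and>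
                   Y = P ** diag_mat (\<chi> i. h (d $ i)) ** transpose P)"

text \<open>The matrix \<open>X log X\<close> is formed on the eigenvalues; as \<open>0 * ln 0 = 0\<close>, this includes
  the convention \<open>0 log 0 = 0\<close> for singular \<open>X\<close>.\<close>

definition entropy :: "real^'n^'n \<Rightarrow> real" where
  "entropy X = - trace (spectral_fun (\<lambda>t. t * ln t) X)"


definition moment_map :: "('m \<Rightarrow> real^'n^'n) \<Rightarrow> real^'n^'n \<Rightarrow> real^'m" where
  "moment_map A X = (\<chi> i. trace (A i ** X))"

definition pencil :: "('m::finite \<Rightarrow> real^'n^'n) \<Rightarrow> real^'m \<Rightarrow> real^'n^'n" where
  "pencil A y = (\<Sum>i\<in>UNIV. (y $ i) *\<^sub>R A i)"

definition moment_body :: "('m::finite \<Rightarrow> real^'n^'n) \<Rightarrow> (real^'m) set" where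
  "moment_body A = moment_map A ` spectraplex"

text \<open>Linear independence of a family; injectivity excludes repeated members.\<close>

definition lin_indep_family :: "('i \<Rightarrow> 'v::real_vector) \<Rightarrow> bool" where
  "lin_indep_family F \<longleftrightarrow> inj F \<and> independent (range F)"

definition dual_obj :: "('m::finite \<Rightarrow> real^'n^'n) \<Rightarrow> real^'m \<Rightarrow> real^'m \<Rightarrow> real" where
  "dual_obj A b y = ln (trace (mat_exp (pencil A y))) - b \<bullet> y"

definition feasible :: "('m::finite \<Rightarrow> real^'n^'n) \<Rightarrow> real^'m \<Rightarrow> (real^'n^'n) set" where
  "feasible A b = {X \<in> spectraplex. moment_map A X = b}"

definition dual_value :: "('m::finite \<Rightarrow> real^'n^'n) \<Rightarrow> real^'m \<Rightarrow> real" where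
  "dual_value A b = (INF y. dual_obj A b y)"

definition primal_value :: "('m::finite \<Rightarrow> real^'n^'n) \<Rightarrow> real^'m \<Rightarrow> real" where
  "primal_value A b = (SUP X\<in>feasible A b. entropy X)"


lemma diag_mat_mult_right: "(M ** diag_mat d) $ i $ j = M $ i $ j * d $ j"
  by (simp add: matrix_matrix_mult_def diag_mat_def if_distrib sum.delta cong: if_cong)

lemma diag_mat_mult_left: "(diag_mat d ** M) $ i $ j = d $ i * M $ i $ j"
  by (simp add: matrix_matrix_mult_def diag_mat_def if_distrib [of "\<lambda>x. x * _"] cong: if_cong)

lemma spectral_fun_unique:
  fixes P Q :: "real^'n^'n"
  assumes P: "orthogonal_matrix P" and Q: "orthogonal_matrix Q"
    and eq: "P ** diag_mat d ** transpose P = Q ** diag_mat e ** transpose Q"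
  shows "P ** diag_mat (\<chi> i. h (d $ i)) ** transpose P =
         Q ** diag_mat (\<chi> i. h (e $ i)) ** transpose Q"
proof -
  define U where "U = transpose Q ** P"
  have PP: "transpose P ** P = mat 1" "P ** transpose P = mat 1"
    and QQ: "transpose Q ** Q = mat 1" "Q ** transpose Q = mat 1"
    using P Q by (auto simp: orthogonal_matrix_def)
  have "U ** diag_mat d = transpose Q ** (P ** diag_mat d ** transpose P) ** P"
    by (simp add: U_def matrix_mul_assoc[symmetric] PP)
  also have "\<dots> = diag_mat e ** U"
    unfolding eq by (simp add: U_def matrix_mul_assoc QQ)
  finally have UD: "U ** diag_mat d = diag_mat e ** U" .
  have "U $ i $ j * d $ j = e $ i * U $ i $ j" for i j
    using UD by (metis diag_mat_mult_left diag_mat_mult_right)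
  then have "U $ i $ j = 0 \<or> d $ j = e $ i" for i j
    by (metis mult.commute mult_cancel_left)
  then have "U $ i $ j * h (d $ j) = h (e $ i) * U $ i $ j" for i j
    by (metis mult.commute mult_zero_left)
  then have UH: "U ** diag_mat (\<chi> i. h (d $ i)) = diag_mat (\<chi> i. h (e $ i)) ** U"
    by (simp add: vec_eq_iff diag_mat_mult_left diag_mat_mult_right)
  have "P ** diag_mat (\<chi> i. h (d $ i)) ** transpose P
      = Q ** (U ** diag_mat (\<chi> i. h (d $ i))) ** transpose P"
    by (simp add: U_def matrix_mul_assoc QQ)
  also have "\<dots> = Q ** diag_mat (\<chi> i. h (e $ i)) ** transpose Q"
    unfolding UH by (simp add: U_def matrix_mul_assoc[symmetric] PP)
  finally show ?thesis .
qed

lemma spectral_fun_eq: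
  assumes "orthogonal_matrix P"
  shows "spectral_fun h (P ** diag_mat d ** transpose P) =
         P ** diag_mat (\<chi> i. h (d $ i)) ** transpose P"
  unfolding spectral_fun_def
proof (rule the_equality)
  show "\<exists>P' d'. orthogonal_matrix P' \<and>
      P ** diag_mat d ** transpose P = P' ** diag_mat d' ** transpose P' \<and>
      P ** diag_mat (\<chi> i. h (d $ i)) ** transpose P =
      P' ** diag_mat (\<chi> i. h (d' $ i)) ** transpose P'"
    using assms by blast
next
  fix Y
  assume "\<exists>P' d'. orthogonal_matrix P' \<and>
      P ** diag_mat d ** transpose P = P' ** diag_mat d' ** transpose P' \<and>
      Y = P' ** diag_mat (\<chi> i. h (d' $ i)) ** transpose P'"
  then show "Y = P ** diag_mat (\<chi> i. h (d $ i)) ** transpose P"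
    using spectral_fun_unique[OF assms] by metis
qed

lemma spectral_fun_xlogx:
  fixes X :: "real^'n^'n"
  assumes "orthogonal_matrix P" and "X = P ** diag_mat d ** transpose P"
  shows "spectral_fun (\<lambda>t. t * ln t) X = X ** spectral_fun ln X"
proof -
  have PP: "transpose P ** (P ** M) = M" for M :: "real^'n^'n"
    using assms(1) by (simp add: orthogonal_matrix_def matrix_mul_assoc)
  have D: "diag_mat (\<chi> i. d $ i * ln (d $ i)) = diag_mat d ** diag_mat (\<chi> i. ln (d $ i))"
    by (simp add: vec_eq_iff diag_mat_mult_left) (simp add: diag_mat_def)
  then show ?thesis
    unfolding assms(2) spectral_fun_eq[OF assms(1)]
    by (simp add: matrix_mul_assoc[symmetric] PP D)
qed

end

theory Submission
  imports Defs
begin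

text \<open>The theorem rests on the Gibbs variational principle (\<open>gibbs_variational_principle\<close>): for
  symmetric \<open>Z\<close> and \<open>X\<close> in the spectraplex, \<open>entropy X + X \<bullet> Z \<le> ln (trace (mat_exp Z))\<close>, with
  equality exactly for \<open>X = mat_exp1 Z\<close>. With \<open>Z = pencil A y\<close> it says that the dual objective
  \<open>f y\<close> is the maximum of the Lagrangian \<open>entropy X + (moment_map A X - b) \<bullet> y\<close> over the
  spectraplex, attained only at \<open>X = mat_exp1 (pencil A y)\<close>.

  As a maximum of affine functions of \<open>y\<close>, \<open>f\<close> is convex, hence continuous. A ball of radius \<open>e\<close>
  around \<open>b\<close> inside the moment body supplies Lagrangians that show \<open>f y \<ge> e * norm y\<close>
  (\<open>dual_obj_coercive\<close>), so \<open>f\<close> has a minimizer \<open>ystar\<close>. The residual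
  \<open>moment_map A (mat_exp1 (pencil A y)) - b\<close> is a subgradient of \<open>f\<close> at \<open>y\<close> and depends
  continuously on \<open>y\<close>; it therefore vanishes at \<open>ystar\<close> (\<open>dual_minimizer_moments\<close>), which makes
  \<open>Xstar = mat_exp1 (pencil A ystar)\<close> feasible.

  For feasible \<open>X\<close> the Lagrangian is just the entropy, so \<open>entropy X \<le> f ystar\<close> with equality only
  for \<open>X = Xstar\<close>: this is strong duality and uniqueness of the primal maximizer. Another dual
  minimizer would have the same exponential \<open>Xstar\<close>; taking logarithms, its pencil differs from
  that of \<open>ystar\<close> by a multiple of the identity, and linear independence makes the two equal.

  Entropy is concave (\<open>concave_on_entropy\<close>) because passing to the diagonal in any orthonormal
  basis can only raise it, while nothing is lost in the eigenbasis of the matrix itself.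

  Both the Gibbs principle and the diagonal bound are reduced to real numbers by spectral
  decompositions (\<open>sym_mats_spectral_decomposition\<close>, obtained from the Rayleigh quotient): the
  squared overlaps between two orthonormal eigenbases form a doubly stochastic matrix.\<close>

section \<open>The spectral theorem for real symmetric matrices\<close>

lemma sym_mats_inner:
  assumes "X \<in> sym_mats"
  shows "(X *v u) \<bullet> w = u \<bullet> (X *v w)"
  using assms by (metis (mono_tags) dot_lmul_matrix mem_Collect_eq sym_mats_def transpose_matrix_vector)

text \<open>A maximizer \<open>v\<close> of the Rayleigh quotient over the unit sphere of the invariant
  subspace is an eigenvector: the residual \<open>w = X v - c v\<close> lies in the subspace, and moving
  from \<open>v\<close> in its direction would raise the
  quotient at the rate \<open>2 (w \<bullet> w)\<close>, which must therefore vanish.\<close>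

lemma sym_mats_eigenvector:
  fixes X :: "real^'n^'n"
  assumes X: "X \<in> sym_mats" and S: "subspace S" "x \<in> S" "x \<noteq> 0"
    and inv: "\<And>v. v \<in> S \<Longrightarrow> X *v v \<in> S"
  obtains v c where "v \<in> S" "norm v = 1" "X *v v = c *\<^sub>R v"
proof -
  have "compact (S \<inter> sphere 0 1)"
    using S(1) by (simp add: closed_Int_compact closed_subspace)
  moreover have "(1 / norm x) *\<^sub>R x \<in> S \<inter> sphere 0 1"
    using S by (simp add: subspace_scale)
  moreover have "continuous_on (S \<inter> sphere 0 1) (\<lambda>v. v \<bullet> (X *v v))"
    by (intro continuous_intros matrix_vector_mult_linear_continuous_on)
  ultimately obtain v where v: "v \<in> S" "norm v = 1"
    and max: "\<And>u. u \<in> S \<Longrightarrow> norm u = 1 \<Longrightarrow> u \<bullet> (X *v u) \<le> v \<bullet> (X *v v)"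
    using continuous_attains_sup[of "S \<inter> sphere 0 1" "\<lambda>v. v \<bullet> (X *v v)"] by fastforce
  define c where "c = v \<bullet> (X *v v)"
  define w where "w = X *v v - c *\<^sub>R v"
  have w: "w \<in> S" unfolding w_def using S(1) v(1) inv by (simp add: subspace_diff subspace_scale)
  have rayleigh: "u \<bullet> (X *v u) \<le> c * (u \<bullet> u)" if "u \<in> S" for u
  proof (cases "u = 0")
    case False
    have "((1 / norm u) *\<^sub>R u) \<bullet> (X *v ((1 / norm u) *\<^sub>R u)) \<le> c"
      unfolding c_def using S(1) that False by (intro max) (auto simp: subspace_scale)
    then have "u \<bullet> (X *v u) / (norm u)\<^sup>2 \<le> c"
      by (simp add: matrix_vector_mult_scaleR power2_eq_square)
    then show ?thesis using False by (simp add: divide_le_eq power2_norm_eq_inner)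
  qed simp
  have vv: "v \<bullet> v = 1" using v(2) by (simp add: norm_eq_1)
  have vw: "w \<bullet> (X *v v) - c * (w \<bullet> v) = w \<bullet> w"
    by (simp add: w_def inner_diff_right)
  \<comment> \<open>The quadratic form stays maximal along \<open>v + t w\<close>, so its first-order term vanishes.\<close>
  define q where "q = c * (w \<bullet> w) - w \<bullet> (X *v w)"
  have quad: "2 * t * (w \<bullet> w) \<le> t\<^sup>2 * q" for t
  proof -
    have "v + t *\<^sub>R w \<in> S" using S(1) v(1) w by (simp add: subspace_add subspace_scale)
    from rayleigh[OF this] have "2 * t * (w \<bullet> (X *v v)) + t\<^sup>2 * (w \<bullet> (X *v w))
        \<le> c * (2 * t * (w \<bullet> v)) + t\<^sup>2 * (c * (w \<bullet> w))"
      using sym_mats_inner[OF X, of v w] vv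
      by (simp add: matrix_vector_right_distrib matrix_vector_mult_scaleR inner_add_left
          inner_add_right c_def[symmetric] inner_commute power2_eq_square algebra_simps)
    then show ?thesis
      unfolding q_def using vw by (simp add: algebra_simps)
  qed
  have "w \<bullet> w = 0"
  proof (rule ccontr)
    assume "w \<bullet> w \<noteq> 0"
    then have pos: "w \<bullet> w > 0" by (simp add: less_le)
    \<comment> \<open>Small enough for the second-order term to be dominated by the first-order term.\<close>
    define t where "t = (w \<bullet> w) / (\<bar>q\<bar> + 1)"
    have t: "t > 0" using pos by (simp add: t_def add_nonneg_pos)
    have "2 * (w \<bullet> w) \<le> t * q"
      using quad[of t] t by (simp add: power2_eq_square)
    also have "\<dots> \<le> t * (\<bar>q\<bar> + 1)" using t by (intro mult_left_mono) auto
    also have "\<dots> = w \<bullet> w" by (simp add: t_def add_nonneg_pos)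
    finally show False using pos by simp
  qed
  then have "X *v v = c *\<^sub>R v" by (simp add: w_def)
  with that v show thesis by blast
qed

text \<open>Eigenvectors are collected one at a time: the orthogonal complement of those already
  found is again invariant, because the matrix is symmetric.\<close>

lemma sym_mats_orthonormal_eigenvectors:
  fixes X :: "real^'n^'n"
  assumes X: "X \<in> sym_mats" and "k \<le> CARD('n)"
  shows "\<exists>B. finite B \<and> card B = k \<and> pairwise orthogonal B \<and>
             (\<forall>v\<in>B. norm v = 1 \<and> (\<exists>c. X *v v = c *\<^sub>R v))"
  using assms(2)
proof (induction k)
  case 0
  show ?case by (rule exI[of _ "{}"]) simp
next
  case (Suc k)
  then obtain B where B: "finite B" "card B = k" "pairwise orthogonal B"
    and ev: "\<And>v. v \<in> B \<Longrightarrow> norm v = 1 \<and> (\<exists>c. X *v v = c *\<^sub>R v)"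
    by (meson Suc_leD)
  define S where "S = {y. \<forall>u\<in>B. orthogonal u y}"
  have "dim B < DIM(real^'n)"
    using dim_le_card'[OF B(1)] B(2) Suc.prems by simp
  then obtain x where "x \<noteq> 0" "\<And>y. y \<in> span B \<Longrightarrow> orthogonal x y"
    by (rule orthogonal_to_subspace_exists) blast
  then have x: "x \<noteq> 0" "x \<in> S"
    by (auto simp: S_def orthogonal_commute span_base)
  have "X *v y \<in> S" if "y \<in> S" for y
  proof -
    have "u \<bullet> (X *v y) = 0" if u: "u \<in> B" for u
    proof -
      obtain c where "X *v u = c *\<^sub>R u" using ev u by blast
      then show ?thesis
        using sym_mats_inner[OF X, of u y] u \<open>y \<in> S\<close> by (simp add: S_def orthogonal_def)
    qed
    then show ?thesis by (simp add: S_def orthogonal_def)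
  qed
  then obtain v c where v: "v \<in> S" "norm v = 1" "X *v v = c *\<^sub>R v"
    using sym_mats_eigenvector[OF X, of S x] x subspace_orthogonal_to_vectors[of B]
    unfolding S_def by blast
  have "v \<notin> B" using v by (auto simp: S_def orthogonal_def norm_eq_1)
  then show ?case
    using B ev v by (intro exI[of _ "insert v B"])
      (auto simp: pairwise_insert S_def orthogonal_commute)
qed

theorem sym_mats_spectral_decomposition:
  fixes X :: "real^'n^'n"
  assumes X: "X \<in> sym_mats"
  obtains P d where "orthogonal_matrix P" "X = P ** diag_mat d ** transpose P"
proof -
  obtain B where B: "finite B" "card B = CARD('n)" "pairwise orthogonal B"
    and ev: "\<And>v. v \<in> B \<Longrightarrow> norm v = 1 \<and> (\<exists>c. X *v v = c *\<^sub>R v)"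
    using sym_mats_orthonormal_eigenvectors[OF X order_refl] by blast
  obtain h where h: "bij_betw h (UNIV :: 'n set) B"
    using B finite_same_card_bij[of "UNIV :: 'n set" B] by auto
  then have hB: "h j \<in> B" for j by (auto simp: bij_betw_def)
  then have "\<forall>j. \<exists>c. X *v h j = c *\<^sub>R h j" using ev by blast
  then obtain c where c: "\<And>j. X *v h j = c j *\<^sub>R h j" by metis
  define P :: "real^'n^'n" where "P = (\<chi> i j. h j $ i)"
  have col: "column j P = h j" for j by (simp add: P_def column_def vec_eq_iff)
  have P: "orthogonal_matrix P"
    unfolding orthogonal_matrix_orthonormal_columns col
    using ev hB B(3) h by (auto simp: pairwise_def bij_betw_def inj_eq)
  have "(X ** P) $ i $ j = (P ** diag_mat (\<chi> j. c j)) $ i $ j" for i j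
  proof -
    have "(X ** P) $ i $ j = (X *v column j P) $ i"
      by (simp add: matrix_matrix_mult_def matrix_vector_mult_def column_def)
    then show ?thesis by (simp add: col c diag_mat_mult_right) (simp add: P_def)
  qed
  then have "X ** P = P ** diag_mat (\<chi> j. c j)" by (simp add: vec_eq_iff)
  then have "P ** diag_mat (\<chi> j. c j) ** transpose P = X ** (P ** transpose P)"
    by (simp add: matrix_mul_assoc)
  then have "X = P ** diag_mat (\<chi> j. c j) ** transpose P"
    using P by (simp add: orthogonal_matrix_def)
  with P that show thesis by blast
qed

section \<open>Calculus of spectral decompositions\<close>

lemma sym_mats_nth: "X \<in> sym_mats \<Longrightarrow> X $ i $ j = X $ j $ i"
  by (simp add: sym_mats_def transpose_def vec_eq_iff)

lemma subspace_sym_mats: "subspace (sym_mats :: (real^'n^'n) set)"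
  by (auto simp: subspace_def sym_mats_def transpose_def vec_eq_iff)

lemma trace_scaleR: "trace (c *\<^sub>R X) = c * trace (X :: real^'n^'n)"
  by (simp add: trace_def sum_distrib_left)

text \<open>The inner product on \<open>real^'n^'n\<close> is the sum over all entries. Identifying the
  trace pairing with it makes bilinearity and symmetry of the pairing available at once.\<close>

lemma trace_mult_sym_mats:
  assumes "X \<in> sym_mats"
  shows "trace (X ** Y) = X \<bullet> Y"
proof -
  have "trace (X ** Y) = (\<Sum>i\<in>UNIV. \<Sum>k\<in>UNIV. X $ k $ i * Y $ k $ i)"
    unfolding trace_def matrix_matrix_mult_def
    by (simp add: sym_mats_nth[OF assms])
  then show ?thesis
    by (subst (asm) sum.swap) (simp add: inner_vec_def)
qed

abbreviation eig_mat :: "real^'n^'n \<Rightarrow> real^'n \<Rightarrow> real^'n^'n" where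
  "eig_mat P d \<equiv> P ** diag_mat d ** transpose P"

lemma diag_mat_mult_vec: "diag_mat d *v w = (\<chi> i. d $ i * w $ i)"
  by (simp add: vec_eq_iff matrix_vector_mult_def diag_mat_def if_distrib [of "\<lambda>x. x * _"]
      cong: if_cong)

lemma matrix_add_mult_distrib: "(X + Y) ** Z = X ** Z + Y ** (Z :: real^'n^'m)"
  by (simp add: vec_eq_iff matrix_matrix_mult_def distrib_right sum.distrib)

lemma eig_mat_sym: "eig_mat P d \<in> sym_mats"
proof -
  have "transpose (diag_mat d) = diag_mat d" by (simp add: vec_eq_iff transpose_def diag_mat_def)
  then show ?thesis by (simp add: sym_mats_def matrix_transpose_mul matrix_mul_assoc)
qed

lemma eig_mat_mult:
  assumes "orthogonal_matrix P"
  shows "eig_mat P d ** eig_mat P e = eig_mat P (\<chi> i. d $ i * e $ i)"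
proof -
  have "diag_mat d ** diag_mat e = diag_mat (\<chi> i. d $ i * e $ i)"
    by (simp add: vec_eq_iff diag_mat_mult_left) (simp add: diag_mat_def)
  moreover have "eig_mat P d ** eig_mat P e
      = P ** (diag_mat d ** (transpose P ** P) ** diag_mat e) ** transpose P"
    by (simp add: matrix_mul_assoc)
  ultimately show ?thesis using assms by (simp add: orthogonal_matrix_def)
qed

lemma eig_mat_const:
  fixes P :: "real^'n^'n"
  assumes "orthogonal_matrix P"
  shows "eig_mat P (\<chi> i. c) = c *\<^sub>R mat 1"
proof -
  have "diag_mat (\<chi> i. c) = c *\<^sub>R (mat 1 :: real^'n^'n)" by (simp add: vec_eq_iff diag_mat_def mat_def)
  then show ?thesis
    using assms by (simp add: matrix_scalar_ac scalar_matrix_assoc[symmetric] orthogonal_matrix_def)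
qed

lemma linear_eig_mat:
  fixes P :: "real^'n^'n"
  shows "linear (eig_mat P)"
proof (rule linearI)
  fix d e :: "real^'n" and c :: real
  have "diag_mat (d + e) = diag_mat d + diag_mat e" "diag_mat (c *\<^sub>R d) = c *\<^sub>R diag_mat d"
    by (simp_all add: vec_eq_iff diag_mat_def)
  then show "eig_mat P (d + e) = eig_mat P d + eig_mat P e"
    "eig_mat P (c *\<^sub>R d) = c *\<^sub>R eig_mat P d"
    by (simp_all add: matrix_add_ldistrib matrix_add_mult_distrib matrix_scalar_ac
        scalar_matrix_assoc[symmetric])
qed

lemma trace_eig_mat:
  assumes "orthogonal_matrix P"
  shows "trace (eig_mat P d) = (\<Sum>i\<in>UNIV. d $ i)"
proof -
  have "trace (eig_mat P d) = trace (transpose P ** (P ** diag_mat d))"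
    by (rule trace_mul_sym)
  also have "\<dots> = trace (diag_mat d)"
    using assms by (simp add: matrix_mul_assoc orthogonal_matrix_def)
  finally show ?thesis by (simp add: trace_def diag_mat_def)
qed

text \<open>Two symmetric matrices need not commute, but their trace pairing only sees the squares of
  the overlaps between the eigenvectors. For orthogonal \<open>P\<close> and \<open>Q\<close> these squares form a doubly
  stochastic matrix (\<open>orthogonal_matrix_weights\<close>), which is what reduces the matrix
  inequalities below to inequalities for real numbers.\<close>

lemma inner_eig_mat:
  "eig_mat P d \<bullet> eig_mat Q e =
    (\<Sum>i\<in>UNIV. \<Sum>j\<in>UNIV. ((transpose P ** Q) $ i $ j)\<^sup>2 * (d $ i * e $ j))"
proof -
  define U where "U = transpose P ** Q"
  have "eig_mat P d \<bullet> eig_mat Q e = trace (P ** (diag_mat d ** U ** diag_mat e ** transpose Q))"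
    by (simp add: trace_mult_sym_mats[OF eig_mat_sym, symmetric] U_def matrix_mul_assoc)
  also have "\<dots> = trace ((diag_mat d ** U ** diag_mat e) ** (transpose Q ** P))"
    by (subst trace_mul_sym) (simp add: matrix_mul_assoc)
  also have "transpose Q ** P = transpose U" by (simp add: U_def matrix_transpose_mul)
  also have "trace ((diag_mat d ** U ** diag_mat e) ** transpose U)
      = (\<Sum>i\<in>UNIV. \<Sum>j\<in>UNIV. (diag_mat d ** U ** diag_mat e) $ i $ j * U $ i $ j)"
    by (simp add: trace_def transpose_def matrix_matrix_mult_def[of "diag_mat d ** U ** diag_mat e"])
  also have "\<dots> = (\<Sum>i\<in>UNIV. \<Sum>j\<in>UNIV. (U $ i $ j)\<^sup>2 * (d $ i * e $ j))"
    by (simp add: diag_mat_mult_left diag_mat_mult_right power2_eq_square mult_ac)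
  finally show ?thesis by (simp add: U_def)
qed

lemma orthogonal_matrix_weights:
  fixes U :: "real^'n^'n"
  assumes "orthogonal_matrix U"
  shows "(\<Sum>j\<in>UNIV. (U $ i $ j)\<^sup>2) = 1" and "(\<Sum>i\<in>UNIV. (U $ i $ j)\<^sup>2) = 1"
proof -
  have "(U ** transpose U) $ i $ i = 1" "(transpose U ** U) $ j $ j = 1"
    using assms by (simp_all add: orthogonal_matrix_def mat_def)
  then show "(\<Sum>j\<in>UNIV. (U $ i $ j)\<^sup>2) = 1" "(\<Sum>i\<in>UNIV. (U $ i $ j)\<^sup>2) = 1"
    by (simp_all add: matrix_matrix_mult_def transpose_def power2_eq_square)
qed

lemma quadratic_form_eig_mat:
  "v \<bullet> (eig_mat P d *v v) = (\<Sum>k\<in>UNIV. d $ k * ((transpose P *v v) $ k)\<^sup>2)"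
proof -
  have "v \<bullet> (eig_mat P d *v v) = v \<bullet> (P *v (diag_mat d *v (transpose P *v v)))"
    by (simp only: matrix_vector_mul_assoc matrix_mul_assoc)
  also have "\<dots> = (transpose P *v v) \<bullet> (diag_mat d *v (transpose P *v v))"
    by (simp add: dot_lmul_matrix)
  finally show ?thesis
    by (simp add: diag_mat_mult_vec inner_vec_def power2_eq_square mult_ac)
qed

lemma pos_semidef_eig_mat:
  assumes "orthogonal_matrix P"
  shows "pos_semidef (eig_mat P d) \<longleftrightarrow> (\<forall>i. 0 \<le> d $ i)"
proof
  assume L: "pos_semidef (eig_mat P d)"
  show "\<forall>i. 0 \<le> d $ i"
  proof
    fix i
    have "transpose P *v (P *v axis i 1) = axis i 1"
      using assms by (simp only: matrix_vector_mul_assoc orthogonal_matrix_def matrix_vector_mul_lid)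
    then have "(P *v axis i 1) \<bullet> (eig_mat P d *v (P *v axis i 1)) = d $ i"
      by (simp only: quadratic_form_eig_mat) (simp add: axis_def if_distrib[of "\<lambda>x. _ * x\<^sup>2"] cong: if_cong)
    then show "0 \<le> d $ i" using L by (metis pos_semidef_def)
  qed
next
  assume "\<forall>i. 0 \<le> d $ i"
  then show "pos_semidef (eig_mat P d)"
    unfolding pos_semidef_def quadratic_form_eig_mat
    by (auto simp: eig_mat_sym intro!: sum_nonneg)
qed

lemma pos_def_eig_mat:
  assumes P: "orthogonal_matrix P" and d: "\<And>i. 0 < d $ i"
  shows "pos_def (eig_mat P d)"
proof -
  have "0 < v \<bullet> (eig_mat P d *v v)" if "v \<noteq> 0" for v
  proof -
    have "P *v (transpose P *v v) = v"
      using P by (simp only: matrix_vector_mul_assoc orthogonal_matrix_def matrix_vector_mul_lid)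
    with that have "transpose P *v v \<noteq> 0" by (metis matrix_vector_mult_0_right)
    then obtain k where "(transpose P *v v) $ k \<noteq> 0" by (metis vec_eq_iff zero_index)
    then show ?thesis
      unfolding quadratic_form_eig_mat using d
      by (intro sum_pos2[of UNIV k]) (auto simp: less_imp_le)
  qed
  then show ?thesis by (simp add: pos_def_def eig_mat_sym)
qed

lemma entropy_eig_mat:
  assumes "orthogonal_matrix P"
  shows "entropy (eig_mat P d) = - (\<Sum>i\<in>UNIV. d $ i * ln (d $ i))"
  by (simp add: entropy_def spectral_fun_eq[OF assms] trace_eig_mat[OF assms])

lemma spectraplex_eig_mat:
  assumes "X \<in> spectraplex"
  obtains P d where "orthogonal_matrix P" "X = eig_mat P d" "\<And>i. 0 \<le> d $ i"
    "(\<Sum>i\<in>UNIV. d $ i) = 1"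
proof -
  have X: "pos_semidef X" "trace X = 1" using assms by (auto simp: spectraplex_def)
  then obtain P d where P: "orthogonal_matrix P" "X = eig_mat P d"
    using sym_mats_spectral_decomposition by (metis pos_semidef_def)
  show thesis
    by (rule that[OF P]) (use X P pos_semidef_eig_mat trace_eig_mat in \<open>metis+\<close>)
qed

section \<open>The matrix exponential\<close>

lemma bounded_bilinear_matrix_mult:
  "bounded_bilinear ((**) :: real^'n^'m \<Rightarrow> real^'k^'n \<Rightarrow> real^'k^'m)"
  unfolding bilinear_conv_bounded_bilinear[symmetric] bilinear_def
  by (auto intro!: linearI simp: matrix_add_ldistrib matrix_add_mult_distrib matrix_scalar_ac
      scalar_matrix_assoc)

lemma mat_exp_eig_mat:
  assumes P: "orthogonal_matrix P"
  shows "mat_exp (eig_mat P d) = eig_mat P (\<chi> i. exp (d $ i))"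
proof -
  have pow: "(((**) (eig_mat P d)) ^^ k) (mat 1) = eig_mat P (\<chi> i. d $ i ^ k)" for k
  proof (induction k)
    case 0
    show ?case using eig_mat_const[OF P, of 1] by simp
  next
    case (Suc k)
    then show ?case by (simp add: eig_mat_mult[OF P])
  qed
  have "(\<lambda>k. (1 / fact k) *\<^sub>R (\<chi> i. d $ i ^ k)) sums (\<chi> i. exp (d $ i))"
    unfolding sums_def
  proof (rule vec_tendstoI)
    fix i
    show "(\<lambda>n. (\<Sum>k<n. (1 / fact k) *\<^sub>R (\<chi> i. d $ i ^ k)) $ i) \<longlonglongrightarrow> (\<chi> i. exp (d $ i)) $ i"
      using exp_converges[of "d $ i"] by (simp add: sums_def divide_inverse mult.commute)
  qed
  then have "(\<lambda>k. eig_mat P ((1 / fact k) *\<^sub>R (\<chi> i. d $ i ^ k))) sums eig_mat P (\<chi> i. exp (d $ i))"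
    by (rule bounded_linear.sums[OF linear_conv_bounded_linear[THEN iffD1, OF linear_eig_mat]])
  then have "(\<lambda>k. (1 / fact k) *\<^sub>R eig_mat P (\<chi> i. d $ i ^ k)) sums eig_mat P (\<chi> i. exp (d $ i))"
    by (simp only: linear_cmul[OF linear_eig_mat])
  then show ?thesis
    unfolding mat_exp_def pow by (rule sums_unique[symmetric])
qed

text \<open>The Frobenius norm of a product is bounded by a constant \<open>K\<close> times the product of the
  norms, so on each ball the exponential series is dominated by a scalar exponential series and
  converges uniformly.\<close>

lemma continuous_mat_exp: "continuous_on UNIV (mat_exp :: real^'n^'n \<Rightarrow> real^'n^'n)"
proof -
  define p :: "nat \<Rightarrow> real^'n^'n \<Rightarrow> real^'n^'n" where "p = (\<lambda>k Z. (((**) Z) ^^ k) (mat 1))"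
  have p_simps: "p 0 Z = mat 1" "p (Suc k) Z = Z ** p k Z" for k Z
    by (simp_all add: p_def)
  obtain K where K: "K > 0" "\<And>(Z :: real^'n^'n) (W :: real^'n^'n). norm (Z ** W) \<le> norm Z * norm W * K"
    using bounded_bilinear.pos_bounded[OF bounded_bilinear_matrix_mult] by blast
  have p_norm: "norm (p k Z) \<le> norm (mat 1 :: real^'n^'n) * (norm Z * K) ^ k" for k Z
  proof (induction k)
    case (Suc k)
    have "norm (p (Suc k) Z) \<le> norm Z * norm (p k Z) * K" unfolding p_simps by (rule K(2))
    also have "\<dots> \<le> norm Z * (norm (mat 1 :: real^'n^'n) * (norm Z * K) ^ k) * K"
      using Suc K(1) by (intro mult_right_mono mult_left_mono) auto
    finally show ?case by (simp add: mult_ac)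
  qed (simp add: p_simps)
  have p_cont: "continuous_on S (p k)" for S k
  proof (induction k)
    case (Suc k)
    have "continuous_on S (\<lambda>Z. Z ** p k Z)"
      by (intro bounded_bilinear.continuous_on[OF bounded_bilinear_matrix_mult] continuous_on_id Suc)
    then show ?case by (simp add: p_simps(2)[abs_def])
  qed (simp add: p_simps(1)[abs_def])
  have "continuous_on (ball 0 r) (mat_exp :: real^'n^'n \<Rightarrow> real^'n^'n)" for r
  proof (rule uniform_limit_theorem)
    have "summable (\<lambda>k. norm (mat 1 :: real^'n^'n) * (inverse (fact k) * (r * K) ^ k))"
      by (intro summable_mult summable_exp)
    moreover have "norm ((1 / fact k) *\<^sub>R p k Z)
        \<le> norm (mat 1 :: real^'n^'n) * (inverse (fact k) * (r * K) ^ k)" if "Z \<in> ball 0 r" for k Z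
    proof -
      have "norm (p k Z) \<le> norm (mat 1 :: real^'n^'n) * (r * K) ^ k"
        using that K(1) by (intro order_trans[OF p_norm] mult_left_mono power_mono) auto
      then have "norm (p k Z) / fact k \<le> norm (mat 1 :: real^'n^'n) * (r * K) ^ k / fact k"
        by (rule divide_right_mono) simp
      then show ?thesis by (simp add: divide_inverse mult_ac)
    qed
    ultimately show "uniform_limit (ball 0 r) (\<lambda>n Z. \<Sum>k<n. (1 / fact k) *\<^sub>R p k Z) mat_exp sequentially"
      unfolding mat_exp_def[abs_def] p_def by (intro Weierstrass_m_test) 
    show "\<forall>\<^sub>F n in sequentially. continuous_on (ball 0 r) (\<lambda>Z. \<Sum>k<n. (1 / fact k) *\<^sub>R p k Z)"
      by (intro always_eventually allI continuous_intros p_cont)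
  qed simp
  then have "isCont mat_exp Z" for Z :: "real^'n^'n"
    by (metis continuous_on_eq_continuous_at centre_in_ball open_ball dist_0_norm
        gt_ex mem_ball)
  then show ?thesis by (simp add: continuous_at_imp_continuous_on)
qed

section \<open>Scalar entropy inequalities\<close>

text \<open>This is \<open>ln t \<le> t - 1\<close> at \<open>t = p / x\<close>, multiplied by \<open>x\<close>; the form without division
  remains valid at \<open>x = 0\<close>.\<close>

lemma log_gap:
  fixes x p :: real
  assumes "0 \<le> x" "0 < p"
  shows "x * ln p - x * ln x \<le> p - x" and "x * ln p - x * ln x = p - x \<Longrightarrow> x = p"
proof -
  have *: "x * ln p - x * ln x = x * ln (p / x)" "p - x = x * (p / x - 1)" if "x > 0"
    using that assms by (simp_all add: ln_div algebra_simps)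
  show "x * ln p - x * ln x \<le> p - x"
  proof (cases "x = 0")
    case False
    with assms have "x * ln (p / x) \<le> x * (p / x - 1)"
      by (intro mult_left_mono ln_le_minus_one) auto
    then show ?thesis using * False assms by simp
  qed (use assms in simp)
  show "x = p" if "x * ln p - x * ln x = p - x"
  proof (cases "x = 0")
    case False
    then have "ln (p / x) = p / x - 1" using * that assms by simp
    then have "p / x = 1" using False assms by (intro ln_eq_minus_one) auto
    then show ?thesis using False by simp
  qed (use assms that in simp)
qed

text \<open>By \<open>log_gap\<close>, \<open>- x ln x\<close> is the infimum over \<open>p > 0\<close> of the affine functions
  \<open>p - x - x ln p\<close>, and for \<open>x > 0\<close> the bound is attained at \<open>p = x\<close>. Taking \<open>p\<close> to be the
  mixture gives concavity up to the endpoint \<open>0\<close>, where the derivative is infinite; if the mixture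
  itself is \<open>0\<close>, both of its terms are.\<close>

lemma concave_on_neg_x_ln_x: "concave_on {0..} (\<lambda>t :: real. - (t * ln t))"
  unfolding concave_on_iff
proof (intro conjI ballI allI impI)
  fix x y u v :: real
  assume xy: "x \<in> {0..}" "y \<in> {0..}" and uv: "0 \<le> u" "0 \<le> v" "u + v = 1"
  define p where "p = u * x + v * y"
  have p0: "0 \<le> p" using xy uv by (simp add: p_def)
  have "p * ln p \<le> u * (x * ln x) + v * (y * ln y)"
  proof (cases "p = 0")
    case True
    then have "u * x = 0" "v * y = 0" using xy uv by (auto simp: p_def add_nonneg_eq_0_iff)
    then show ?thesis using True by auto
  next
    case False
    have "u * (x * ln p - x * ln x) + v * (y * ln p - y * ln y) \<le> u * (p - x) + v * (p - y)"
      using log_gap(1)[of x p] log_gap(1)[of y p] xy uv False p0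
      by (intro add_mono mult_left_mono) auto
    also have "\<dots> = (u + v) * p - (u * x + v * y)" by (simp add: algebra_simps)
    also have "\<dots> = 0" using uv(3) by (simp add: p_def)
    finally show ?thesis by (simp add: p_def algebra_simps)
  qed
  then show "u * - (x * ln x) + v * - (y * ln y)
      \<le> - ((u *\<^sub>R x + v *\<^sub>R y) * ln (u *\<^sub>R x + v *\<^sub>R y))"
    by (simp add: p_def)
qed simp

section \<open>The Gibbs variational principle\<close>

lemma trace_mat_exp_pos:
  assumes "Z \<in> sym_mats"
  shows "0 < trace (mat_exp Z)"
proof -
  obtain Q z where Q: "orthogonal_matrix Q" "Z = eig_mat Q z"
    using sym_mats_spectral_decomposition[OF assms] .
  show ?thesis by (simp add: Q mat_exp_eig_mat trace_eig_mat sum_pos)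
qed

lemma mat_exp1_eig_mat:
  fixes z :: "real^'n"
  assumes Q: "orthogonal_matrix Q"
  defines "T \<equiv> \<Sum>i\<in>UNIV. exp (z $ i)"
  shows "mat_exp1 (eig_mat Q z) = eig_mat Q (\<chi> i. exp (z $ i) / T)"
proof -
  have "mat_exp1 (eig_mat Q z) = eig_mat Q ((1 / T) *\<^sub>R (\<chi> i. exp (z $ i)))"
    by (simp only: mat_exp1_def mat_exp_eig_mat[OF Q] trace_eig_mat[OF Q]
        linear_cmul[OF linear_eig_mat]) (simp add: T_def)
  also have "(1 / T) *\<^sub>R (\<chi> i. exp (z $ i)) = (\<chi> i. exp (z $ i) / T)"
    by (simp add: vec_eq_iff)
  finally show ?thesis .
qed

lemma mat_exp1_in_spectraplex:
  assumes "Z \<in> sym_mats"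
  shows "mat_exp1 Z \<in> spectraplex" and "pos_def (mat_exp1 Z)"
proof -
  obtain Q z where Q: "orthogonal_matrix Q" "Z = eig_mat Q z"
    using sym_mats_spectral_decomposition[OF assms] .
  have T: "0 < (\<Sum>i\<in>UNIV. exp (z $ i))" by (simp add: sum_pos)
  show pd: "pos_def (mat_exp1 Z)"
    unfolding Q(2) mat_exp1_eig_mat[OF Q(1)] using T by (intro pos_def_eig_mat Q) auto
  have "pos_semidef (mat_exp1 Z)"
    using pd unfolding pos_def_def pos_semidef_def by (metis inner_zero_left less_imp_le order_refl)
  moreover have "trace (mat_exp1 Z) = 1"
    using trace_mat_exp_pos[OF assms] by (simp add: mat_exp1_def trace_scaleR)
  ultimately show "mat_exp1 Z \<in> spectraplex" by (simp add: spectraplex_def)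
qed

text \<open>Write \<open>x\<close> for the eigenvalues of \<open>X\<close>, \<open>p\<close> for those of \<open>mat_exp1 Z\<close>, and \<open>w i j\<close> for the
  squared overlaps of the eigenvectors. The difference of the two sides is
  \<open>\<Sum>i j. w i j * (x i ln (x i) - x i ln (p j))\<close>, the relative entropy of \<open>X\<close> and \<open>mat_exp1 Z\<close>.
  Since the weights are doubly stochastic and \<open>x\<close>, \<open>p\<close> both sum to \<open>1\<close>, adding \<open>p j - x i\<close>
  inside does not change the sum, and by \<open>log_gap\<close> every term is then nonnegative. If all
  terms vanish, then \<open>x i = p j\<close> wherever the overlap is nonzero, which says exactly that the two
  matrices coincide.\<close>

theorem gibbs_variational_principle:
  assumes X: "X \<in> spectraplex" and Z: "Z \<in> sym_mats"
  shows "entropy X + X \<bullet> Z \<le> ln (trace (mat_exp Z))"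
    and "entropy X + X \<bullet> Z = ln (trace (mat_exp Z)) \<longleftrightarrow> X = mat_exp1 Z"
proof -
  obtain P x where P: "orthogonal_matrix P" "X = eig_mat P x" and x: "\<And>i. 0 \<le> x $ i"
    and x1: "(\<Sum>i\<in>UNIV. x $ i) = 1"
    using spectraplex_eig_mat[OF X] by blast
  obtain Q z where Q: "orthogonal_matrix Q" "Z = eig_mat Q z"
    using sym_mats_spectral_decomposition[OF Z] .
  define T where "T = (\<Sum>i\<in>UNIV. exp (z $ i))"
  have T: "0 < T" by (simp add: T_def sum_pos)
  have trT: "trace (mat_exp Z) = T" by (simp add: Q mat_exp_eig_mat trace_eig_mat T_def)
  define p where "p = (\<chi> i. exp (z $ i) / T)"
  have p: "0 < p $ j" for j using T by (simp add: p_def)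
  have ln_p: "ln (p $ j) = z $ j - ln T" for j using T by (simp add: p_def ln_div)
  have p1: "(\<Sum>j\<in>UNIV. p $ j) = 1"
    using T by (simp add: p_def sum_divide_distrib[symmetric]) (simp add: T_def)
  define U where "U = transpose P ** Q"
  have "orthogonal_matrix U" using P Q by (simp add: U_def orthogonal_matrix_mul)
  note w = orthogonal_matrix_weights[OF this]
  define gap where "gap = (\<lambda>i j. (p $ j - x $ i) - (x $ i * ln (p $ j) - x $ i * ln (x $ i)))"
  have gap: "0 \<le> gap i j" for i j using log_gap(1)[OF x p] by (simp add: gap_def)
  have rows: "(\<Sum>i\<in>UNIV. \<Sum>j\<in>UNIV. (U $ i $ j)\<^sup>2 * g i) = (\<Sum>i\<in>UNIV. g i)" for g :: "_ \<Rightarrow> real"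
    by (simp add: sum_distrib_right[symmetric] w)
  have cols: "(\<Sum>i\<in>UNIV. \<Sum>j\<in>UNIV. (U $ i $ j)\<^sup>2 * g j) = (\<Sum>j\<in>UNIV. g j)" for g :: "_ \<Rightarrow> real"
    by (subst sum.swap) (simp add: sum_distrib_right[symmetric] w)
  have "(\<Sum>i\<in>UNIV. \<Sum>j\<in>UNIV. (U $ i $ j)\<^sup>2 * gap i j)
      = (\<Sum>i\<in>UNIV. \<Sum>j\<in>UNIV. (U $ i $ j)\<^sup>2 * p $ j)
        - (\<Sum>i\<in>UNIV. \<Sum>j\<in>UNIV. (U $ i $ j)\<^sup>2 * x $ i)
        - (\<Sum>i\<in>UNIV. \<Sum>j\<in>UNIV. (U $ i $ j)\<^sup>2 * (x $ i * z $ j))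
        + (\<Sum>i\<in>UNIV. \<Sum>j\<in>UNIV. (U $ i $ j)\<^sup>2 * (x $ i * ln T))
        + (\<Sum>i\<in>UNIV. \<Sum>j\<in>UNIV. (U $ i $ j)\<^sup>2 * (x $ i * ln (x $ i)))"
    by (simp add: sum_subtractf[symmetric] sum.distrib[symmetric] gap_def ln_p algebra_simps)
  also have "\<dots> = ln T - (entropy X + X \<bullet> Z)"
    unfolding rows cols
    by (simp add: x1 p1 sum_distrib_right[symmetric] P(2) Q(2) entropy_eig_mat[OF P(1)]
        inner_eig_mat U_def)
  finally have main: "ln (trace (mat_exp Z)) - (entropy X + X \<bullet> Z)
      = (\<Sum>i\<in>UNIV. \<Sum>j\<in>UNIV. (U $ i $ j)\<^sup>2 * gap i j)" by (simp add: trT)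
  have "0 \<le> (\<Sum>i\<in>UNIV. \<Sum>j\<in>UNIV. (U $ i $ j)\<^sup>2 * gap i j)"
    by (intro sum_nonneg mult_nonneg_nonneg gap) auto
  with main show "entropy X + X \<bullet> Z \<le> ln (trace (mat_exp Z))" by simp
  have expZ: "mat_exp1 Z = eig_mat Q p"
    unfolding Q(2) mat_exp1_eig_mat[OF Q(1)] by (simp add: p_def T_def)
  show "entropy X + X \<bullet> Z = ln (trace (mat_exp Z)) \<longleftrightarrow> X = mat_exp1 Z"
  proof
    assume "entropy X + X \<bullet> Z = ln (trace (mat_exp Z))"
    with main have "(\<Sum>i\<in>UNIV. \<Sum>j\<in>UNIV. (U $ i $ j)\<^sup>2 * gap i j) = 0" by simp
    then have zero: "(U $ i $ j)\<^sup>2 * gap i j = 0" for i j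
      by (simp add: sum_nonneg_eq_0_iff sum_nonneg gap)
    have "U $ i $ j = 0 \<or> x $ i = p $ j" for i j
      using zero[of i j] log_gap(2)[OF x p, of i j] by (auto simp: gap_def)
    then have "x $ i * U $ i $ j = U $ i $ j * p $ j" for i j by (metis mult.commute mult_zero_left)
    then have "diag_mat x ** U = U ** diag_mat p"
      by (simp add: vec_eq_iff diag_mat_mult_left diag_mat_mult_right)
    then have "P ** (diag_mat x ** U) ** transpose Q = P ** (U ** diag_mat p) ** transpose Q"
      by simp
    then have "P ** diag_mat x ** transpose P ** (Q ** transpose Q)
        = (P ** transpose P) ** Q ** diag_mat p ** transpose Q"
      by (simp add: U_def matrix_mul_assoc)
    then have "eig_mat P x = eig_mat Q p" using P(1) Q(1) by (simp add: orthogonal_matrix_def)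
    then show "X = mat_exp1 Z" by (simp only: P(2) expZ)
  next
    assume "X = mat_exp1 Z"
    then have X: "X = eig_mat Q p" by (simp add: expZ)
    have "transpose Q ** Q = mat 1" using Q(1) by (simp add: orthogonal_matrix_def)
    then have "X \<bullet> Z = (\<Sum>i\<in>UNIV. p $ i * z $ i)"
      by (simp add: X Q(2) inner_eig_mat mat_def if_distrib[of "\<lambda>t. t\<^sup>2 * _"] cong: if_cong)
    moreover have "entropy X = - (\<Sum>i\<in>UNIV. p $ i * z $ i) + ln T"
      by (simp add: X entropy_eig_mat[OF Q(1)] ln_p right_diff_distrib sum_subtractf
          sum_distrib_right[symmetric] p1)
    ultimately show "entropy X + X \<bullet> Z = ln (trace (mat_exp Z))" by (simp add: trT)
  qed
qed

lemma entropy_nonneg: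
  assumes "X \<in> spectraplex"
  shows "0 \<le> entropy X"
proof -
  obtain P x where P: "orthogonal_matrix P" "X = eig_mat P x" and x: "\<And>i. 0 \<le> x $ i"
    and x1: "(\<Sum>i\<in>UNIV. x $ i) = 1"
    using spectraplex_eig_mat[OF assms] by blast
  have "x $ i \<le> 1" for i
    using x1 member_le_sum[of i UNIV "\<lambda>i. x $ i"] x by simp
  then have "0 \<le> - (x $ i * ln (x $ i))" for i
    using x[of i] by (cases "x $ i = 0") (auto simp: mult_nonneg_nonpos)
  then have "0 \<le> (\<Sum>i\<in>UNIV. - (x $ i * ln (x $ i)))" by (intro sum_nonneg)
  then show ?thesis by (simp add: P entropy_eig_mat sum_negf)
qed

section \<open>Concavity of the entropy\<close>

lemma convex_spectraplex: "convex (spectraplex :: (real^'n^'n) set)"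
proof (rule convexI)
  fix X Y :: "real^'n^'n" and u v :: real
  assume *: "X \<in> spectraplex" "Y \<in> spectraplex" "0 \<le> u" "0 \<le> v" "u + v = 1"
  have "u *\<^sub>R X + v *\<^sub>R Y \<in> sym_mats"
    using * by (intro subspace_add subspace_scale subspace_sym_mats)
      (auto simp: spectraplex_def pos_semidef_def)
  then show "u *\<^sub>R X + v *\<^sub>R Y \<in> spectraplex"
    using * by (simp add: spectraplex_def pos_semidef_def trace_add trace_scaleR
        matrix_vector_mult_add_rdistrib inner_add_right scaleR_matrix_vector_assoc[symmetric])
qed

text \<open>Here \<open>\<delta> k X\<close> is the \<open>k\<close>-th diagonal entry of \<open>X\<close> in the basis of columns of \<open>P\<close>: it is the
  pairing with the rank-one projection onto that column, hence linear in \<open>X\<close>. Forgetting the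
  off-diagonal entries raises the entropy, because the diagonal is a doubly stochastic average
  of the eigenvalues and \<open>- t ln t\<close> is concave.\<close>

lemma entropy_le_pinched:
  fixes X P :: "real^'n^'n"
  assumes X: "X \<in> spectraplex" and P: "orthogonal_matrix P"
  defines "\<delta> \<equiv> \<lambda>k Y. eig_mat P (axis k 1) \<bullet> Y"
  shows "entropy X \<le> - (\<Sum>k\<in>UNIV. \<delta> k X * ln (\<delta> k X))" and "0 \<le> \<delta> k X"
proof -
  obtain Q x where Q: "orthogonal_matrix Q" "X = eig_mat Q x" and x: "\<And>i. 0 \<le> x $ i"
    using spectraplex_eig_mat[OF X] by blast
  define U where "U = transpose P ** Q"
  have "orthogonal_matrix U" using P Q by (simp add: U_def orthogonal_matrix_mul)
  note w = orthogonal_matrix_weights[OF this]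
  have \<delta>: "\<delta> k X = (\<Sum>j\<in>UNIV. (U $ k $ j)\<^sup>2 * x $ j)" for k
  proof -
    have "\<delta> k X = (\<Sum>i\<in>UNIV. if i = k then \<Sum>j\<in>UNIV. (U $ i $ j)\<^sup>2 * x $ j else 0)"
      unfolding \<delta>_def Q(2) inner_eig_mat U_def by (intro sum.cong) (auto simp: axis_def)
    then show ?thesis by simp
  qed
  show "0 \<le> \<delta> k X" by (simp add: \<delta> sum_nonneg x)
  have "(\<Sum>j\<in>UNIV. (U $ k $ j)\<^sup>2 * - (x $ j * ln (x $ j))) \<le> - (\<delta> k X * ln (\<delta> k X))" for k
    using concave_on_sum[OF _ _ concave_on_neg_x_ln_x, of UNIV "\<lambda>j. (U $ k $ j)\<^sup>2" "\<lambda>j. x $ j"]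
    by (simp add: w x \<delta>)
  then have "(\<Sum>k\<in>UNIV. \<Sum>j\<in>UNIV. (U $ k $ j)\<^sup>2 * - (x $ j * ln (x $ j)))
      \<le> (\<Sum>k\<in>UNIV. - (\<delta> k X * ln (\<delta> k X)))"
    by (intro sum_mono)
  also have "(\<Sum>k\<in>UNIV. \<Sum>j\<in>UNIV. (U $ k $ j)\<^sup>2 * - (x $ j * ln (x $ j))) = entropy X"
    by (subst sum.swap) (simp only: sum_distrib_right[symmetric] w Q(2) entropy_eig_mat[OF Q(1)],
      simp add: sum_negf)
  finally show "entropy X \<le> - (\<Sum>k\<in>UNIV. \<delta> k X * ln (\<delta> k X))" by (simp add: sum_negf)
qed

text \<open>In the eigenbasis of the mixture \<open>W\<close>, the diagonal of \<open>W\<close> carries its whole entropy and is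
  the mixture of the diagonals of \<open>X\<close> and \<open>Y\<close>. Scalar concavity compares \<open>W\<close> with these two
  diagonals, and \<open>entropy_le_pinched\<close> compares the diagonals with \<open>X\<close> and \<open>Y\<close>. No logarithm
  of a singular matrix is involved, so boundary points of the spectraplex need no limit.\<close>

theorem concave_on_entropy: "concave_on spectraplex (entropy :: real^'n^'n \<Rightarrow> real)"
  unfolding concave_on_iff
proof (intro conjI convex_spectraplex ballI allI impI)
  fix X Y :: "real^'n^'n" and u v :: real
  assume XY: "X \<in> spectraplex" "Y \<in> spectraplex" and uv: "0 \<le> u" "0 \<le> v" "u + v = 1"
  define W where "W = u *\<^sub>R X + v *\<^sub>R Y"
  have "W \<in> spectraplex" unfolding W_def using XY uv by (intro convexD[OF convex_spectraplex])
  then obtain P d where P: "orthogonal_matrix P" "W = eig_mat P d"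
    by (rule spectraplex_eig_mat)
  define h :: "real \<Rightarrow> real" where "h = (\<lambda>t. - (t * ln t))"
  define \<delta> where "\<delta> = (\<lambda>k Y. eig_mat P (axis k 1) \<bullet> Y)"
  have d: "d $ k = \<delta> k W" for k
  proof -
    have PP: "transpose P ** P = mat 1" using P(1) by (simp add: orthogonal_matrix_def)
    have "\<delta> k W = (\<Sum>i\<in>UNIV. \<Sum>j\<in>UNIV. if j = i then axis k 1 $ i * d $ j else 0)"
      unfolding \<delta>_def P(2) inner_eig_mat PP by (intro sum.cong) (auto simp: mat_def)
    also have "\<dots> = (\<Sum>i\<in>UNIV. if i = k then d $ i else 0)"
      by (intro sum.cong) (auto simp: axis_def)
    finally show ?thesis by simp
  qed
  have h_mix: "u * h (\<delta> k X) + v * h (\<delta> k Y) \<le> h (\<delta> k W)" for k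
    using concave_on_neg_x_ln_x[unfolded concave_on_iff] uv
      entropy_le_pinched(2)[OF XY(1) P(1), of k] entropy_le_pinched(2)[OF XY(2) P(1), of k]
    by (simp add: h_def \<delta>_def W_def inner_add_right)
  have "u * entropy X + v * entropy Y
      \<le> u * (\<Sum>k\<in>UNIV. h (\<delta> k X)) + v * (\<Sum>k\<in>UNIV. h (\<delta> k Y))"
    using entropy_le_pinched(1)[OF XY(1) P(1)] entropy_le_pinched(1)[OF XY(2) P(1)] uv
    by (intro add_mono mult_left_mono) (auto simp: h_def \<delta>_def sum_negf)
  also have "\<dots> \<le> (\<Sum>k\<in>UNIV. h (\<delta> k W))"
    using h_mix by (simp add: sum_distrib_left sum.distrib[symmetric] sum_mono)
  also have "\<dots> = entropy W"
    unfolding P(2) entropy_eig_mat[OF P(1)] by (simp add: h_def d[symmetric] sum_negf P(2)[symmetric])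
  finally show "u * entropy X + v * entropy Y \<le> entropy (u *\<^sub>R X + v *\<^sub>R Y)" by (simp add: W_def)
qed

section \<open>Duality\<close>

text \<open>Up to a multiple of the identity, \<open>Z\<close> can be recovered from \<open>mat_exp1 Z\<close>; together with the
  independence of the identity from the \<open>A i\<close> this yields uniqueness of the dual minimizer.\<close>

lemma spectral_fun_ln_mat_exp1:
  assumes "Z \<in> sym_mats"
  shows "spectral_fun ln (mat_exp1 Z) = Z - ln (trace (mat_exp Z)) *\<^sub>R mat 1"
proof -
  obtain Q z where Q: "orthogonal_matrix Q" "Z = eig_mat Q z"
    using sym_mats_spectral_decomposition[OF assms] .
  define T where "T = (\<Sum>i\<in>UNIV. exp (z $ i))"
  have T: "0 < T" by (simp add: T_def sum_pos)
  have "(\<chi> i. ln ((\<chi> i. exp (z $ i) / T) $ i)) = z - (\<chi> i. ln T)"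
    using T by (simp add: vec_eq_iff ln_div)
  then have "spectral_fun ln (mat_exp1 Z) = eig_mat Q (z - (\<chi> i. ln T))"
    by (simp only: Q(2) mat_exp1_eig_mat[OF Q(1)] spectral_fun_eq[OF Q(1)] T_def)
  also have "\<dots> = Z - ln T *\<^sub>R mat 1"
    by (simp only: linear_diff[OF linear_eig_mat] eig_mat_const[OF Q(1)] Q(2))
  finally show ?thesis by (simp add: Q mat_exp_eig_mat trace_eig_mat T_def)
qed

context
  fixes A :: "'m::finite \<Rightarrow> real^'n^'n"
  assumes sym: "range A \<subseteq> sym_mats"
begin

lemma pencil_sym_mats: "pencil A y \<in> sym_mats"
  unfolding pencil_def
  by (intro subspace_sum subspace_scale subspace_sym_mats) (use sym in auto)

lemma moment_map_inner: "moment_map A X = (\<chi> i. A i \<bullet> X)"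
  using sym by (simp add: moment_map_def trace_mult_sym_mats image_subset_iff)

lemma moment_map_adjoint: "moment_map A X \<bullet> y = X \<bullet> pencil A y"
  unfolding pencil_def inner_sum_right inner_vec_def[of "moment_map A X"]
  by (simp add: moment_map_inner inner_commute mult.commute)

lemma convex_feasible: "convex (feasible A b)"
proof (rule convexI)
  fix X Y :: "real^'n^'n" and u v :: real
  assume *: "X \<in> feasible A b" "Y \<in> feasible A b" "0 \<le> u" "0 \<le> v" "u + v = 1"
  have "moment_map A (u *\<^sub>R X + v *\<^sub>R Y) = u *\<^sub>R moment_map A X + v *\<^sub>R moment_map A Y"
    by (simp add: moment_map_inner vec_eq_iff inner_add_right)
  also have "\<dots> = b"
    using * by (simp add: feasible_def scaleR_add_left[symmetric])
  finally show "u *\<^sub>R X + v *\<^sub>R Y \<in> feasible A b"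
    using * convexD[OF convex_spectraplex, of X Y u v] by (simp add: feasible_def)
qed

text \<open>The Gibbs principle at \<open>Z = pencil A y\<close>: the dual objective at \<open>y\<close> is the maximum over the
  spectraplex of the Lagrangian of the primal problem. Weak duality, convexity, coercivity and
  the gradient of the dual objective are all read off from this.\<close>

lemma dual_obj_ge_lagrangian:
  assumes "X \<in> spectraplex"
  shows "entropy X + (moment_map A X - b) \<bullet> y \<le> dual_obj A b y"
    and "entropy X + (moment_map A X - b) \<bullet> y = dual_obj A b y \<longleftrightarrow> X = mat_exp1 (pencil A y)"
  using gibbs_variational_principle[OF assms pencil_sym_mats, of y]
  by (auto simp: dual_obj_def inner_diff_left moment_map_adjoint)

lemma dual_obj_eq_lagrangian:
  assumes "X = mat_exp1 (pencil A y)"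
  shows "dual_obj A b y = entropy X + (moment_map A X - b) \<bullet> y"
  using dual_obj_ge_lagrangian(2)[of X b y] assms mat_exp1_in_spectraplex(1)[OF pencil_sym_mats]
  by simp

text \<open>The maximizer of the Lagrangian at \<open>y\<close> competes in the maximum at \<open>y'\<close>, and there its
  Lagrangian is affine in \<open>y'\<close> with slope equal to the moment residual.\<close>

lemma dual_obj_subgradient:
  "dual_obj A b y - dual_obj A b y' \<le> (moment_map A (mat_exp1 (pencil A y)) - b) \<bullet> (y - y')"
  using dual_obj_eq_lagrangian[OF refl, of b y]
    dual_obj_ge_lagrangian(1)[OF mat_exp1_in_spectraplex(1)[OF pencil_sym_mats], of y b y']
  by (simp add: inner_diff_right)

lemma convex_on_dual_obj: "convex_on UNIV (dual_obj A b)"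
  unfolding convex_on_def
proof (intro conjI ballI allI impI)
  fix y y' :: "real^'m" and u v :: real
  assume uv: "0 \<le> u" "0 \<le> v" "u + v = 1"
  define w where "w = u *\<^sub>R y + v *\<^sub>R y'"
  define g where "g = moment_map A (mat_exp1 (pencil A w)) - b"
  have "u * (dual_obj A b w - dual_obj A b y) + v * (dual_obj A b w - dual_obj A b y')
      \<le> u * (g \<bullet> (w - y)) + v * (g \<bullet> (w - y'))"
    unfolding g_def using uv by (intro add_mono mult_left_mono dual_obj_subgradient) auto
  also have "\<dots> = (u + v) * (g \<bullet> w) - g \<bullet> w"
    by (simp add: w_def inner_diff_right inner_add_right algebra_simps)
  also have "\<dots> = 0" using uv by simp
  finally have "(u + v) * dual_obj A b w \<le> u * dual_obj A b y + v * dual_obj A b y'"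
    by (simp add: algebra_simps)
  then show "dual_obj A b (u *\<^sub>R y + v *\<^sub>R y') \<le> u * dual_obj A b y + v * dual_obj A b y'"
    using uv by (simp add: w_def)
qed simp

text \<open>Some point of the spectraplex has the moments \<open>b + e y / norm y\<close>; its Lagrangian at \<open>y\<close> is its
  entropy, which is nonnegative, plus \<open>e * norm y\<close>.\<close>

lemma dual_obj_coercive:
  assumes "b \<in> interior (moment_body A)"
  obtains e where "0 < e" "\<And>y. e * norm y \<le> dual_obj A b y"
proof -
  obtain e where e: "0 < e" "cball b e \<subseteq> moment_body A"
    using assms by (auto simp: mem_interior_cball)
  have "e * norm y \<le> dual_obj A b y" for y
  proof -
    \<comment> \<open>For \<open>y = 0\<close> the quotient is \<open>0\<close> and the point is \<open>b\<close> itself.\<close>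
    have "b + (e / norm y) *\<^sub>R y \<in> cball b e" using e(1) by (simp add: dist_norm)
    with e(2) obtain X where X: "X \<in> spectraplex" "moment_map A X = b + (e / norm y) *\<^sub>R y"
      by (auto simp: moment_body_def)
    have "e * norm y = (moment_map A X - b) \<bullet> y"
      by (simp add: X(2) dot_square_norm power2_eq_square)
    then show ?thesis using entropy_nonneg[OF X(1)] dual_obj_ge_lagrangian(1)[OF X(1), of b y] by simp
  qed
  with e(1) that show thesis by blast
qed

lemma dual_obj_attains_min:
  assumes "b \<in> interior (moment_body A)"
  obtains ystar where "\<And>y. dual_obj A b ystar \<le> dual_obj A b y"
proof -
  obtain e where e: "0 < e" "\<And>y. e * norm y \<le> dual_obj A b y"
    using dual_obj_coercive[OF assms] by blast
  define r where "r = dual_obj A b 0 / e"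
  have r: "0 \<le> r" using e(1) e(2)[of 0] by (simp add: r_def)
  have "continuous_on (cball 0 r) (dual_obj A b)"
    using convex_on_continuous[OF open_UNIV convex_on_dual_obj] continuous_on_subset by blast
  then obtain ystar where min: "\<And>y. y \<in> cball 0 r \<Longrightarrow> dual_obj A b ystar \<le> dual_obj A b y"
    using continuous_attains_inf[of "cball 0 r" "dual_obj A b"] r
    by (metis (no_types) centre_in_cball compact_cball empty_iff)
  have "dual_obj A b ystar \<le> dual_obj A b y" for y
  proof (cases "y \<in> cball 0 r")
    case False
    then have "dual_obj A b 0 \<le> e * norm y" using e(1) by (simp add: r_def field_simps)
    with e(2)[of y] min[of 0] r show ?thesis by simp
  qed (rule min)
  with that show thesis by blast
qed

lemma continuous_moment_mat_exp1: "continuous_on UNIV (\<lambda>y. moment_map A (mat_exp1 (pencil A y)))"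
proof -
  have "continuous_on UNIV (\<lambda>y. mat_exp (pencil A y))"
    unfolding pencil_def
    by (intro continuous_on_compose2[OF continuous_mat_exp] continuous_intros) auto
  then show ?thesis
    unfolding moment_map_inner mat_exp1_def trace_def
    using trace_mat_exp_pos[OF pencil_sym_mats]
    by (intro continuous_intros) (auto simp: trace_def less_imp_neq[symmetric] dest: less_imp_neq)
qed

text \<open>Write \<open>g y\<close> for the moment residual of \<open>mat_exp1 (pencil A y)\<close>. Along
  a sequence that approaches the minimizer in the direction \<open>- g ystar\<close>, the subgradient
  inequality forces \<open>g (y n) \<bullet> - g ystar \<ge> 0\<close>. As \<open>g\<close> is continuous, the limit gives
  \<open>- (norm (g ystar))\<^sup>2 \<ge> 0\<close>. Continuity of the exponential thus replaces its derivative.\<close>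

lemma dual_minimizer_moments:
  assumes min: "\<And>y. dual_obj A b ystar \<le> dual_obj A b y"
  shows "moment_map A (mat_exp1 (pencil A ystar)) = b"
proof -
  define g where "g = (\<lambda>y. moment_map A (mat_exp1 (pencil A y)) - b)"
  define y where "y = (\<lambda>n. ystar + inverse (real (Suc n)) *\<^sub>R - g ystar)"
  have "0 \<le> g (y n) \<bullet> - g ystar" for n
  proof -
    have "0 \<le> g (y n) \<bullet> (y n - ystar)"
      using dual_obj_subgradient[of b "y n" ystar] min[of "y n"] by (simp add: g_def)
    then show ?thesis by (simp add: y_def zero_le_mult_iff mult_le_0_iff del: of_nat_Suc)
  qed
  moreover have "(\<lambda>n. g (y n) \<bullet> - g ystar) \<longlonglongrightarrow> g ystar \<bullet> - g ystar"
  proof -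
    have "y \<longlonglongrightarrow> ystar + 0 *\<^sub>R - g ystar"
      unfolding y_def by (intro tendsto_intros LIMSEQ_inverse_real_of_nat)
    moreover have "continuous_on UNIV g"
      unfolding g_def by (intro continuous_intros continuous_moment_mat_exp1)
    ultimately have "(\<lambda>n. g (y n)) \<longlonglongrightarrow> g ystar"
      using continuous_on_tendsto_compose[of UNIV g y ystar] by simp
    then show ?thesis by (intro tendsto_intros)
  qed
  ultimately have "0 \<le> g ystar \<bullet> - g ystar" by (intro LIMSEQ_le_const) auto
  then have "g ystar \<bullet> g ystar = 0" using inner_ge_zero[of "g ystar"] by simp
  then show ?thesis by (simp add: g_def)
qed

text \<open>The coefficient of the identity is carried by \<open>None\<close>. As independence is a statement about
  the range of the family, coefficients are transported there along the inverse of the injective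
  family.\<close>

lemma pencil_diff_scalar_imp_eq:
  assumes indep: "lin_indep_family (case_option (mat 1) A)"
    and eq: "pencil A y - pencil A y' = c *\<^sub>R mat 1"
  shows "y = y'"
proof -
  define F where "F = case_option (mat 1) A"
  define g where "g = case_option (- c) (\<lambda>i. y $ i - y' $ i)"
  have F: "inj F" "independent (range F)" using indep by (auto simp: lin_indep_family_def F_def)
  have "(\<Sum>X\<in>range F. g (inv F X) *\<^sub>R X) = (\<Sum>i\<in>UNIV. g i *\<^sub>R F i)"
    using F(1) by (simp add: sum.reindex)
  also have "\<dots> = - c *\<^sub>R mat 1 + (\<Sum>i\<in>UNIV. (y $ i - y' $ i) *\<^sub>R A i)"
    by (simp add: UNIV_option_conv sum.reindex F_def g_def)
  also have "\<dots> = 0"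
    using eq by (simp add: pencil_def scaleR_diff_left sum_subtractf)
  finally have "g (inv F (F (Some i))) = 0" for i
    by (intro real_vector.independentD[OF F(2)]) auto
  then show ?thesis using F(1) by (simp add: g_def vec_eq_iff)
qed

end

theorem theorem1:
  fixes A :: "'m::finite \<Rightarrow> real^'n^'n" and b :: "real^'m"
  assumes sym: "\<And>i. A i \<in> sym_mats"
    and indep: "lin_indep_family (case_option (mat 1) A)"
    and b: "b \<in> interior (moment_body A)"
  shows "convex_on UNIV (dual_obj A b) \<and>
    concave_on spectraplex (entropy :: real^'n^'n \<Rightarrow> real) \<and>
    convex (feasible A b) \<and>
    primal_value A b = dual_value A b \<and>
    (\<exists>ystar Xstar.
       (\<forall>y. is_arg_min (dual_obj A b) (\<lambda>_. True) y \<longleftrightarrow> y = ystar) \<and>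
       (\<forall>X. is_arg_max entropy (\<lambda>X. X \<in> feasible A b) X \<longleftrightarrow> X = Xstar) \<and>
       Xstar = mat_exp1 (pencil A ystar) \<and>
       pos_def Xstar \<and>
       moment_map A Xstar = b)"
proof -
  have symA: "range A \<subseteq> sym_mats" using sym by blast
  obtain ystar where ystar: "\<And>y. dual_obj A b ystar \<le> dual_obj A b y"
    using dual_obj_attains_min[OF symA b] by blast
  define Xstar where "Xstar = mat_exp1 (pencil A ystar)"
  have spec: "Xstar \<in> spectraplex" and pd: "pos_def Xstar"
    using mat_exp1_in_spectraplex[OF pencil_sym_mats[OF symA]] by (simp_all add: Xstar_def)
  have moments: "moment_map A Xstar = b"
    unfolding Xstar_def by (rule dual_minimizer_moments[OF symA ystar])
  have feas: "Xstar \<in> feasible A b" using spec moments by (simp add: feasible_def)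
  have dual_eq: "dual_obj A b ystar = entropy Xstar"
    using dual_obj_eq_lagrangian[OF symA Xstar_def] moments by simp
  have weak: "entropy X \<le> dual_obj A b y"
    and tight: "entropy X = dual_obj A b y \<longleftrightarrow> X = mat_exp1 (pencil A y)"
    if "X \<in> feasible A b" for X y
    using that dual_obj_ge_lagrangian[OF symA, of X b y] by (simp_all add: feasible_def)
  \<comment> \<open>For a second minimizer \<open>y\<close>, the point \<open>Xstar\<close> attains the Gibbs bound at \<open>y\<close> as well, so both
     exponentials agree and the pencils differ by a multiple of the identity.\<close>
  have min_unique: "y = ystar" if "dual_obj A b y \<le> dual_obj A b ystar" for y
  proof -
    have "entropy Xstar = dual_obj A b y" using that ystar[of y] dual_eq by simp
    then have "mat_exp1 (pencil A y) = mat_exp1 (pencil A ystar)"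
      unfolding tight[OF feas] by (simp add: Xstar_def)
    then have "spectral_fun ln (mat_exp1 (pencil A y)) = spectral_fun ln (mat_exp1 (pencil A ystar))"
      by simp
    then have "pencil A y - pencil A ystar
        = (ln (trace (mat_exp (pencil A y))) - ln (trace (mat_exp (pencil A ystar)))) *\<^sub>R mat 1"
      by (simp add: spectral_fun_ln_mat_exp1[OF pencil_sym_mats[OF symA]] scaleR_diff_left algebra_simps)
    then show ?thesis by (rule pencil_diff_scalar_imp_eq[OF symA indep])
  qed
  have max: "entropy X \<le> entropy Xstar" if "X \<in> feasible A b" for X
    using weak[OF that, of ystar] dual_eq by linarith
  have max_unique: "X = Xstar" if "X \<in> feasible A b" "entropy Xstar \<le> entropy X" for X
  proof -
    have "entropy X = dual_obj A b ystar" using max[OF that(1)] that(2) dual_eq by linarith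
    then show ?thesis unfolding tight[OF that(1)] Xstar_def .
  qed
  have "primal_value A b = entropy Xstar"
    unfolding primal_value_def using feas max by (intro cSup_eq_maximum) auto
  moreover have "dual_value A b = dual_obj A b ystar"
    unfolding dual_value_def using ystar by (intro cInf_eq_minimum) auto
  moreover have "is_arg_min (dual_obj A b) (\<lambda>_. True) y \<longleftrightarrow> y = ystar" for y
    unfolding is_arg_min_linorder using ystar min_unique by blast
  moreover have "is_arg_max entropy (\<lambda>X. X \<in> feasible A b) X \<longleftrightarrow> X = Xstar" for X
    unfolding is_arg_max_linorder using feas max max_unique by blast
  ultimately show ?thesis
    using convex_on_dual_obj[OF symA] concave_on_entropy convex_feasible[OF symA] dual_eq pd moments
      Xstar_def by (intro conjI exI[of _ ystar] exI[of _ Xstar] allI) simp_all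
qed

end
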